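(* Let $\mathcal{W}$ be a standard sequence of generating words with bounded spacers such that the minimal Ferenczi subshift $(X_{\mathcal{W}}, S)$ is aperiodic. Then $(X_{\mathcal{W}}, S)$ has a unique asymptotic class.
   Context: $S$ is the shift; a subshift is aperiodic if it is nonempty and contains no shift-periodic point. Ferenczi subshifts. Given nonnegative integers $(q_n)_{n \ge 0}$ (cutting parameters) and $(a_{n,i} : n \ge 0, 0 \le i < q_n)$ (spacer parameters), the sequence of generating words $\mathcal{W} = (w_n)_{n \ge 0}$ over $\{0,1\}$ is $w_0 = 0$, $w_{n+1} = w_n 1^{a_{n,0}} w_n 1^{a_{n,1}} \cdots w_n 1^{a_{n,q_n-1}} w_n$. $X_{\mathcal{W}}$ is the set of $x \in \{0,1\}^{\mathbb{Z}}$ every finite factor of which is a factor of some $w_n$. $\mathcal{W}$ is standard if $q_n \ge 2$ for all $n$. If the spacers are bounded, $(X_{\mathcal{W}},S)$ is minimal. Asymptotic classes. In a topological dynamical system $(X,T)$ with metric $d$, points $x,y$ are asymptotic if $\lim_{n \to +\infty} d(T^n x, T^n y) = 0$. Write $x \sim y$ if $x$ is asymptotic to $T^k y$ for some $k \in \mathbb{Z}$; this is an equivalence relation. An asymptotic class is an equivalence class of $\sim$ that is not the orbit of a single point. *)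

theory Defs
  imports "HOL-Analysis.Analysis" "HOL-Library.Sublist"
begin

section \<open>Asymptotic classes\<close>

text \<open>A system consists of a set \<open>X\<close>, a metric \<open>d\<close> on \<open>X\<close> and a map \<open>T\<close> restricting to a
  bijection of \<open>X\<close>; negative powers are powers of the inverse of that restriction.\<close>

definition int_iterate :: "'a set \<Rightarrow> ('a \<Rightarrow> 'a) \<Rightarrow> int \<Rightarrow> 'a \<Rightarrow> 'a" where
  "int_iterate X T k =
     (if 0 \<le> k then T ^^ nat k else inv_into X T ^^ nat (- k))"

definition orbit_of :: "'a set \<Rightarrow> ('a \<Rightarrow> 'a) \<Rightarrow> 'a \<Rightarrow> 'a set" where
  "orbit_of X T x = range (\<lambda>k. int_iterate X T k x)"

definition asymptotic :: "('a \<Rightarrow> 'a \<Rightarrow> real) \<Rightarrow> ('a \<Rightarrow> 'a) \<Rightarrow> 'a \<Rightarrow> 'a \<Rightarrow> bool" where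
  "asymptotic d T x y \<longleftrightarrow> (\<lambda>n. d ((T ^^ n) x) ((T ^^ n) y)) \<longlonglongrightarrow> 0"

definition asymptotic_rel :: "'a set \<Rightarrow> ('a \<Rightarrow> 'a \<Rightarrow> real) \<Rightarrow> ('a \<Rightarrow> 'a) \<Rightarrow> 'a rel" where
  "asymptotic_rel X d T =
     {(x, y) \<in> X \<times> X. \<exists>k. asymptotic d T x (int_iterate X T k y)}"

definition asymptotic_class ::
    "'a set \<Rightarrow> ('a \<Rightarrow> 'a \<Rightarrow> real) \<Rightarrow> ('a \<Rightarrow> 'a) \<Rightarrow> 'a set \<Rightarrow> bool" where
  "asymptotic_class X d T A \<longleftrightarrow>
     A \<in> X // asymptotic_rel X d T \<and> \<not> (\<exists>z\<in>X. A = orbit_of X T z)"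


section \<open>Subshifts\<close>

definition metric_on_subshift ::
    "(int \<Rightarrow> 'a) set \<Rightarrow> ((int \<Rightarrow> 'a) \<Rightarrow> (int \<Rightarrow> 'a) \<Rightarrow> real) \<Rightarrow> bool" where
  "metric_on_subshift X d \<longleftrightarrow>
     Metric_space X d \<and>
     Metric_space.mtopology X d =
       subtopology (product_topology (\<lambda>_. discrete_topology UNIV) UNIV) X"

definition shift :: "(int \<Rightarrow> 'a) \<Rightarrow> int \<Rightarrow> 'a" where
  "shift x = (\<lambda>i. x (i + 1))"

definition aperiodic :: "(int \<Rightarrow> 'a) set \<Rightarrow> bool" where
  "aperiodic X \<longleftrightarrow> X \<noteq> {} \<and> \<not> (\<exists>x\<in>X. \<exists>p>0. (shift ^^ p) x = x)"


section \<open>Ferenczi subshifts\<close>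

text \<open>Only the values \<open>a n i\<close> with \<open>i < q n\<close> are relevant.\<close>

primrec gen_word :: "(nat \<Rightarrow> nat) \<Rightarrow> (nat \<Rightarrow> nat \<Rightarrow> nat) \<Rightarrow> nat \<Rightarrow> nat list" where
  "gen_word q a 0 = [0]"
| "gen_word q a (Suc n) =
     concat (map (\<lambda>i. gen_word q a n @ replicate (a n i) 1) [0..<q n]) @ gen_word q a n"

definition ferenczi_subshift :: "(nat \<Rightarrow> nat) \<Rightarrow> (nat \<Rightarrow> nat \<Rightarrow> nat) \<Rightarrow> (int \<Rightarrow> nat) set" where
  "ferenczi_subshift q a =
     {x. range x \<subseteq> {0, 1} \<and> (\<forall>i j. \<exists>n. sublist (map x [i..j]) (gen_word q a n))}"

definition standard :: "(nat \<Rightarrow> nat) \<Rightarrow> bool" where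
  "standard q \<longleftrightarrow> (\<forall>n. 2 \<le> q n)"

definition bounded_spacers :: "(nat \<Rightarrow> nat) \<Rightarrow> (nat \<Rightarrow> nat \<Rightarrow> nat) \<Rightarrow> bool" where
  "bounded_spacers q a \<longleftrightarrow> (\<exists>C. \<forall>n. \<forall>i<q n. a n i \<le> C)"

end

theory Submission
  imports Defs
begin

text \<open>The numbers of ones following the successive zeros of the generating words form a Toeplitz
  sequence: with \<open>h\<^sub>n = \<Prod>i<n. q\<^sub>i + 1\<close>, a point of the subshift determines for every \<open>n\<close> a residue
  class modulo \<open>h\<^sub>n\<close> of zeros (the holes of level \<open>n\<close>) outside of which its gaps are the
  \<open>h\<^sub>n\<close>-periodic gaps of \<open>w\<^sub>n\<close>. Two different classes for the same right ray would leave no hole and make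
  the ray periodic, which aperiodicity forbids; so the class is determined by any right ray. If two
  points agree to the right of a place where they differ, the gap at that place must be a hole of every
  level, hence everything to its right is \<open>lim w\<^sub>n\<close>. Thus every asymptotic class is that of the points
  \<open>\<dots> w\<^sub>n 1\<^sup>v . w\<^sub>n \<dots>\<close>, where \<open>v\<close> occurs as a spacer at infinitely many levels. Aperiodicity yields at least
  two such \<open>v\<close>, and the corresponding points lie in different orbits.\<close>

section \<open>Spacer sequences\<close>

text \<open>Zeros are numbered from 0, and \<open>s j\<close> counts the ones between zero number
  \<open>j\<close> and the next one. Position 0 always carries zero number 0.\<close>

definition zero_pos :: "(nat \<Rightarrow> nat) \<Rightarrow> nat \<Rightarrow> nat" where
  "zero_pos s k = (\<Sum>j<k. Suc (s j))"

definition ray :: "(nat \<Rightarrow> nat) \<Rightarrow> nat \<Rightarrow> nat" where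
  "ray s i = (if i \<in> range (zero_pos s) then 0 else 1)"

lemma zero_pos_0 [simp]: "zero_pos s 0 = 0"
  and zero_pos_Suc [simp]: "zero_pos s (Suc k) = zero_pos s k + Suc (s k)"
  by (simp_all add: zero_pos_def)

lemma strict_mono_zero_pos: "strict_mono (zero_pos s)"
  by (simp add: strict_mono_Suc_iff)

lemma zero_pos_less_iff [simp]: "zero_pos s j < zero_pos s k \<longleftrightarrow> j < k"
  and zero_pos_le_iff [simp]: "zero_pos s j \<le> zero_pos s k \<longleftrightarrow> j \<le> k"
  using strict_mono_zero_pos[of s]
  by (simp_all add: strict_mono_less strict_mono_less_eq)

lemma le_zero_pos: "k \<le> zero_pos s k"
  by (rule strict_mono_imp_increasing[OF strict_mono_zero_pos])

lemma ray_eq_0_iff: "ray s i = 0 \<longleftrightarrow> i \<in> range (zero_pos s)"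
  by (simp add: ray_def)

lemma ray_zero_pos [simp]: "ray s (zero_pos s k) = 0"
  by (simp add: ray_def)

lemma ray_values: "ray s i \<in> {0, 1}"
  by (simp add: ray_def)

lemma ray_between:
  assumes "zero_pos s k < i" "i < zero_pos s (Suc k)"
  shows "ray s i = 1"
proof -
  have "i \<noteq> zero_pos s j" for j
    using assms by (metis less_Suc_eq_le not_less zero_pos_less_iff)
  then show ?thesis by (auto simp: ray_def)
qed

lemma zero_pos_Suc_shift: "zero_pos (\<lambda>k. s (Suc k)) k + Suc (s 0) = zero_pos s (Suc k)"
  by (induction k) simp_all

lemma ray_Suc_shift: "ray s (Suc (s 0) + i) = ray (\<lambda>k. s (Suc k)) i"
proof -
  have "Suc (s 0) + i \<in> range (zero_pos s) \<longleftrightarrow> i \<in> range (zero_pos (\<lambda>k. s (Suc k)))"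
  proof
    assume "Suc (s 0) + i \<in> range (zero_pos s)"
    then obtain k where k: "Suc (s 0) + i = zero_pos s k" by blast
    then obtain j where "k = Suc j" by (cases k) auto
    with k have "i = zero_pos (\<lambda>k. s (Suc k)) j"
      using zero_pos_Suc_shift[of s j] by (simp del: zero_pos_Suc)
    then show "i \<in> range (zero_pos (\<lambda>k. s (Suc k)))" by blast
  next
    assume "i \<in> range (zero_pos (\<lambda>k. s (Suc k)))"
    then obtain j where "i = zero_pos (\<lambda>k. s (Suc k)) j" by blast
    then have "Suc (s 0) + i = zero_pos s (Suc j)"
      using zero_pos_Suc_shift[of s j] by (simp del: zero_pos_Suc)
    then show "Suc (s 0) + i \<in> range (zero_pos s)" by blast
  qed
  then show ?thesis by (simp add: ray_def)
qed

lemma ray_zero_in_window: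
  assumes "\<And>k. s k \<le> C"
  shows "\<exists>i\<in>{t..t + C}. ray s i = 0"
proof -
  define k where "k = (LEAST k. t \<le> zero_pos s k)"
  have tk: "t \<le> zero_pos s k"
    unfolding k_def by (rule LeastI[of _ t]) (rule le_zero_pos)
  have "zero_pos s k \<le> t + C"
  proof (cases k)
    case (Suc j)
    then have "\<not> t \<le> zero_pos s j"
      using not_less_Least[of j "\<lambda>k. t \<le> zero_pos s k"] k_def by auto
    with assms[of j] Suc show ?thesis by simp
  qed simp
  with tk show ?thesis by (intro bexI[of _ "zero_pos s k"]) auto
qed

text \<open>Inside the window the next zero of either ray is also a zero of the other, so neither
  can come first. Counting zeros thus turns agreement of letters into agreement of gaps.\<close>

lemma zero_pos_match:
  assumes "\<And>i. i \<le> L \<Longrightarrow> ray s i = ray v (zero_pos v z + i)"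
  shows "zero_pos s k \<le> L \<Longrightarrow> zero_pos v (z + k) = zero_pos v z + zero_pos s k"
proof (induction k)
  case (Suc k)
  then have IH: "zero_pos v (z + k) = zero_pos v z + zero_pos s k" by simp
  have "ray v (zero_pos v z + zero_pos s (Suc k)) = 0"
    using assms[OF Suc.prems] by (metis ray_zero_pos)
  then obtain m where m: "zero_pos v z + zero_pos s (Suc k) = zero_pos v m"
    by (auto simp: ray_eq_0_iff)
  have "zero_pos v (z + k) < zero_pos v m" using m IH by simp
  then have "z + Suc k \<le> m" by simp
  then have le: "zero_pos v (z + Suc k) \<le> zero_pos v z + zero_pos s (Suc k)"
    using m by (metis zero_pos_le_iff)
  define i where "i = zero_pos v (z + Suc k) - zero_pos v z"
  have i: "zero_pos v z + i = zero_pos v (z + Suc k)"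
    unfolding i_def by (simp add: zero_pos_le_iff[THEN iffD2] le_add_diff_inverse del: zero_pos_Suc)
  have "i \<le> L" using i le Suc.prems by linarith
  from assms[OF this] have "ray s i = 0" unfolding i by (simp del: zero_pos_Suc)
  then obtain j where j: "i = zero_pos s j" by (auto simp: ray_eq_0_iff)
  have "zero_pos s k < i" using i IH by simp
  then have "Suc k \<le> j" using j by simp
  then have "zero_pos s (Suc k) \<le> i" using j by (metis zero_pos_le_iff)
  with i le show ?case by linarith
qed simp

lemma ray_match:
  assumes "\<And>i. i \<le> L \<Longrightarrow> ray s i = ray v (zero_pos v z + i)" "zero_pos s (Suc k) \<le> L"
  shows "s k = v (z + k)"
proof -
  have "zero_pos v (z + k) = zero_pos v z + zero_pos s k"
    using assms(2) by (intro zero_pos_match[OF assms(1), where L = L]) simp_all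
  moreover have "zero_pos v (z + Suc k) = zero_pos v z + zero_pos s (Suc k)"
    using assms(2) by (intro zero_pos_match[OF assms(1), where L = L])
  ultimately show ?thesis by simp
qed

text \<open>Beyond zero number \<open>m\<close>, any \<open>h\<close> consecutive gaps with their
  zeros occupy the same length \<open>c\<close>, so raising the index of a zero by \<open>h\<close>
  moves it by \<open>c\<close>.\<close>

lemma ray_eventually_periodic:
  assumes "\<And>k. k \<ge> m \<Longrightarrow> s (k + h) = s k" "h > 0"
  obtains c M where "c > 0" "\<And>i. i \<ge> M \<Longrightarrow> ray s (i + c) = ray s i"
proof -
  define c where "c = zero_pos s (m + h) - zero_pos s m"
  have c: "zero_pos s (m + h) = zero_pos s m + c" "c > 0"
    using assms(2) zero_pos_le_iff[of s m "m + h"] zero_pos_less_iff[of s m "m + h"]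
    unfolding c_def by linarith+
  have per: "zero_pos s (k + h) = zero_pos s k + c" if "k \<ge> m" for k
    using that
  proof (induction k rule: dec_induct)
    case (step k)
    then show ?case using assms(1)[of k] by simp
  qed (use c in simp)
  have "i + c \<in> range (zero_pos s) \<longleftrightarrow> i \<in> range (zero_pos s)" if "i \<ge> zero_pos s m" for i
  proof
    assume "i + c \<in> range (zero_pos s)"
    then obtain k where k: "i + c = zero_pos s k" by blast
    with that c have "zero_pos s (m + h) \<le> zero_pos s k" by simp
    then have "m + h \<le> k" by simp
    with per[of "k - h"] k have "i = zero_pos s (k - h)" by simp
    then show "i \<in> range (zero_pos s)" by blast
  next
    assume "i \<in> range (zero_pos s)"
    then obtain k where k: "i = zero_pos s k" by blast
    with that have "m \<le> k" by simp
    from per[OF this] k have "i + c = zero_pos s (k + h)" by simp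
    then show "i + c \<in> range (zero_pos s)" by blast
  qed
  then show thesis using c(2) by (intro that[of c "zero_pos s m"]) (simp_all add: ray_def)
qed

lemma exists_spacer_sequence:
  fixes x :: "nat \<Rightarrow> nat"
  assumes "x 0 = 0" "range x \<subseteq> {0, 1}" "\<And>i. \<exists>j\<ge>i. x j = 0"
  obtains s where "x = ray s"
proof -
  define S where "S = {i. x i = 0}"
  have inf: "infinite S"
    using assms(3) by (auto simp: S_def infinite_nat_iff_unbounded_le)
  define s where "s k = enumerate S (Suc k) - enumerate S k - 1" for k
  have "zero_pos s k = enumerate S k" for k
  proof (induction k)
    case 0
    have "(LEAST n. n \<in> S) = 0"
      by (rule Least_equality) (use assms(1) in \<open>auto simp: S_def\<close>)
    then show ?case by (simp add: enumerate_0)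
  next
    case (Suc k)
    have "enumerate S k < enumerate S (Suc k)" using inf by (rule enumerate_step)
    then show ?case using Suc by (simp add: s_def del: enumerate_Suc)
  qed
  then have "zero_pos s = enumerate S" by auto
  then have "range (zero_pos s) = S" using range_enumerate[OF inf] by simp
  moreover have x01: "x i \<in> {0, 1}" for i using assms(2) by blast
  ultimately have "x i = ray s i" for i
    by (cases "i \<in> S") (use x01[of i] in \<open>auto simp: ray_def S_def\<close>)
  then show thesis using that[of s] by blast
qed

section \<open>The spacer sequence of the generating words\<close>

text \<open>This is the number of zeros of \<open>gen_word q a n\<close>, and the value of place
  \<open>n\<close> in the mixed-radix system whose digit \<open>i\<close> runs from 0 to
  \<open>q i\<close>.\<close>

definition height :: "(nat \<Rightarrow> nat) \<Rightarrow> nat \<Rightarrow> nat" where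
  "height q n = (\<Prod>i<n. Suc (q i))"

text \<open>The \<open>k\<close>-th zero of a generating word, counted from \<open>1\<close>, is followed by a gap inserted at the level
  \<open>l\<close> where the lowest nonzero mixed-radix digit of \<open>k\<close> occurs; this digit, minus one, is the index of
  the spacer. The value at \<open>k = 0\<close> is meaningless.\<close>

definition toeplitz :: "(nat \<Rightarrow> nat) \<Rightarrow> (nat \<Rightarrow> nat \<Rightarrow> nat) \<Rightarrow> nat \<Rightarrow> nat" where
  "toeplitz q a k =
     (let l = LEAST l. \<not> height q (Suc l) dvd k
      in a l (k mod height q (Suc l) div height q l - 1))"

lemma height_0 [simp]: "height q 0 = 1"
  and height_Suc: "height q (Suc n) = height q n * Suc (q n)"
  by (simp_all add: height_def)

lemma height_pos [simp]: "height q n > 0"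
  by (simp add: height_def prod_pos)

lemma height_dvd: "m \<le> n \<Longrightarrow> height q m dvd height q n"
  unfolding height_def by (rule prod_dvd_prod_subset) auto

lemma less_height:
  assumes "\<And>n. 1 \<le> q n"
  shows "n < height q n"
proof (induction n)
  case (Suc n)
  have "2 * height q n \<le> height q (Suc n)"
    using assms[of n] by (simp add: height_Suc)
  with Suc show ?case by simp
qed simp

lemma toeplitz_eq:
  assumes "height q l dvd k" "\<not> height q (Suc l) dvd k"
  shows "toeplitz q a k = a l (k mod height q (Suc l) div height q l - 1)"
proof -
  have "(LEAST l. \<not> height q (Suc l) dvd k) = l"
  proof (rule Least_equality)
    fix m assume "\<not> height q (Suc m) dvd k"
    then show "l \<le> m"
      using assms(1) height_dvd[of "Suc m" l q] by (meson dvd_trans not_less_eq_eq)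
  qed (rule assms)
  then show ?thesis by (simp add: toeplitz_def)
qed

lemma exists_level:
  assumes "\<not> height q n dvd k"
  obtains l where "l < n" "height q l dvd k" "\<not> height q (Suc l) dvd k"
  using assms
proof (induction n arbitrary: thesis)
  case (Suc n)
  show ?case
  proof (cases "height q n dvd k")
    case True
    then show ?thesis using Suc.prems by blast
  next
    case False
    then show ?thesis using Suc.IH Suc.prems(1) less_SucI by blast
  qed
qed simp

text \<open>The level of \<open>k\<close> is below \<open>n\<close>, and the two heights that
  determine level and digit divide \<open>height q n\<close>; hence both survive the
  reduction.\<close>

lemma toeplitz_mod:
  assumes "\<not> height q n dvd k"
  shows "toeplitz q a (k mod height q n) = toeplitz q a k"
proof -
  obtain l where l: "l < n" "height q l dvd k" "\<not> height q (Suc l) dvd k"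
    using exists_level[OF assms] .
  have d: "height q l dvd height q n" "height q (Suc l) dvd height q n"
    using l(1) by (auto intro: height_dvd)
  then have "height q l dvd k mod height q n" "\<not> height q (Suc l) dvd k mod height q n"
    using l by (simp_all add: dvd_mod_iff)
  from toeplitz_eq[OF this, of a] toeplitz_eq[OF l(2,3), of a] show ?thesis
    by (simp add: mod_mod_cancel[OF d(2)])
qed

text \<open>The lower digits vanish and digit \<open>n\<close> is \<open>i\<close>, so this is the
  spacer after copy number \<open>i\<close> of \<open>w\<^sub>n\<close>, with copies counted from
  1.\<close>

lemma toeplitz_mult_height:
  assumes "1 \<le> i" "i \<le> q n"
  shows "toeplitz q a (i * height q n) = a n (i - 1)"
proof -
  have less: "i * height q n < height q (Suc n)"
    using mult_le_mono1[OF assms(2), of "height q n"]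
    by (simp add: height_Suc mult.commute[of "height q n"] add_strict_increasing)
  have "\<not> height q (Suc n) dvd i * height q n"
    using less assms(1) by (simp add: nat_dvd_not_less)
  from toeplitz_eq[OF _ this, of a] less show ?thesis by simp
qed

lemma toeplitz_add:
  assumes "0 < r" "r < height q n"
  shows "toeplitz q a (i * height q n + r) = toeplitz q a r"
proof -
  have "(i * height q n + r) mod height q n = r" using assms by simp
  moreover from this have "\<not> height q n dvd i * height q n + r"
    using assms(1) by (simp add: dvd_eq_mod_eq_0)
  ultimately show ?thesis using toeplitz_mod by metis
qed

lemma toeplitz_is_spacer:
  assumes "\<And>n. 1 \<le> q n" "0 < k"
  obtains l i where "i < q l" "toeplitz q a k = a l i" "\<not> height q (Suc l) dvd k"
proof -
  have "\<not> height q k dvd k"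
    using less_height[OF assms(1), of k] assms(2) by (simp add: nat_dvd_not_less)
  then obtain l where l: "height q l dvd k" "\<not> height q (Suc l) dvd k"
    by (rule exists_level)
  let ?r = "k mod height q (Suc l) div height q l"
  have "?r < Suc (q l)"
    by (metis height_Suc height_pos less_mult_imp_div_less mod_less_divisor mult.commute)
  \<comment> \<open>The digit is at most \<open>q l\<close>, and \<open>q l\<close> is positive, so
    the bound holds under truncated subtraction too.\<close>
  then have "?r - 1 < q l" using assms(1)[of l] by linarith
  then show thesis using that toeplitz_eq[OF l] l(2) by blast
qed

lemma toeplitz_le:
  assumes "\<And>n. 1 \<le> q n" "\<And>n i. i < q n \<Longrightarrow> a n i \<le> C" "0 < k"
  shows "toeplitz q a k \<le> C"
proof -
  obtain l i where "i < q l" "toeplitz q a k = a l i"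
    using assms(1,3) by (rule toeplitz_is_spacer[where a = a])
  with assms(2) show ?thesis by simp
qed

section \<open>Gap lists of the generating words\<close>

definition word_of :: "nat list \<Rightarrow> nat list" where
  "word_of gs = concat (map (\<lambda>g. 0 # replicate g 1) gs) @ [0]"

lemma word_of_append: "word_of (us @ g # vs) = word_of us @ replicate g 1 @ word_of vs"
  by (simp add: word_of_def)

lemma concat_word_of:
  "concat (map (\<lambda>i. word_of u @ replicate (f i) 1) xs) @ word_of u =
   word_of (concat (map (\<lambda>i. u @ [f i]) xs) @ u)"
  by (induction xs) (simp_all add: word_of_append)

text \<open>The index range splits at the multiples of \<open>height q n\<close>: a multiple gives a
  spacer of level \<open>n\<close>, and each stretch between multiples repeats the gaps of
  \<open>w\<^sub>n\<close>. For \<open>i = q n\<close> this is the gap list of the next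
  word.\<close>

lemma map_toeplitz:
  assumes "i \<le> q n"
  shows "map (toeplitz q a) [1..<Suc i * height q n] =
    concat (map (\<lambda>j. map (toeplitz q a) [1..<height q n] @ [a n j]) [0..<i]) @
    map (toeplitz q a) [1..<height q n]"
  using assms
proof (induction i)
  case (Suc i)
  let ?h = "height q n" and ?t = "toeplitz q a"
  have h: "1 \<le> ?h" using height_pos[of q n] by linarith
  let ?m = "Suc i * ?h"
  have m: "1 \<le> ?m" using h by simp
  have "[1..<Suc (Suc i) * ?h] = [1..<?m] @ [?m..<?m + ?h]"
    using upt_add_eq_append[OF m, of ?h] by (simp add: algebra_simps)
  also have "[?m..<?m + ?h] = ?m # [Suc ?m..<?m + ?h]"
    using h by (intro upt_conv_Cons) linarith
  also have "[Suc ?m..<?m + ?h] = map (\<lambda>r. ?m + r) [1..<?h]"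
    using map_add_upt[of ?m ] by (intro nth_equalityI) auto
  finally have "[1..<Suc (Suc i) * ?h] = [1..<?m] @ ?m # map (\<lambda>r. ?m + r) [1..<?h]" .
  moreover have "map ?t (map (\<lambda>r. ?m + r) [1..<?h]) = map ?t [1..<?h]"
    using toeplitz_add[of _ q n a "Suc i"] by auto
  moreover have "?t ?m = a n i"
    using toeplitz_mult_height[of "Suc i" q n a] Suc.prems by simp
  ultimately have "map ?t [1..<Suc (Suc i) * ?h] = map ?t [1..<?m] @ a n i # map ?t [1..<?h]"
    by (simp only: map_append list.map)
  then show ?case using Suc by simp
qed simp

lemma gen_word_eq_word_of: "gen_word q a n = word_of (map (toeplitz q a) [1..<height q n])"
proof (induction n)
  case 0
  then show ?case by (simp add: word_of_def)
next
  case (Suc n)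
  have "height q (Suc n) = Suc (q n) * height q n" by (simp add: height_Suc)
  then have "map (toeplitz q a) [1..<height q (Suc n)] =
    concat (map (\<lambda>j. map (toeplitz q a) [1..<height q n] @ [a n j]) [0..<q n]) @
    map (toeplitz q a) [1..<height q n]"
    by (simp only: map_toeplitz[OF order_refl])
  then show ?case using Suc by (simp only: gen_word.simps concat_word_of)
qed

lemma word_of_eq_ray: "word_of (map s [0..<m]) = map (ray s) [0..<Suc (zero_pos s m)]"
proof (induction m)
  case 0
  show ?case using ray_zero_pos[of s 0] by (simp add: word_of_def)
next
  case (Suc m)
  let ?p = "zero_pos s m"
  have "[0..<Suc (zero_pos s (Suc m))] = [0..<Suc ?p] @ [Suc ?p..<zero_pos s (Suc m)] @ [zero_pos s (Suc m)]"
    using upt_add_eq_append[of 0 "Suc ?p" "s m"] by simp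
  moreover have "map (ray s) [Suc ?p..<zero_pos s (Suc m)] = replicate (s m) 1"
    by (rule nth_equalityI) (simp_all add: ray_between[of s m] nth_append del: upt_Suc)
  ultimately have "map (ray s) [0..<Suc (zero_pos s (Suc m))] =
      map (ray s) [0..<Suc ?p] @ replicate (s m) 1 @ [0]"
    by (simp only: map_append list.map ray_zero_pos)
  moreover have "word_of (map s [0..<Suc m]) = word_of (map s [0..<m]) @ replicate (s m) 1 @ [0]"
    by (simp add: word_of_append) (simp add: word_of_def)
  ultimately show ?case using Suc by simp
qed

text \<open>The one-sided limit of the generating words, all of which are prefixes of it. The
  \<open>Suc\<close> is there because \<open>toeplitz\<close> counts zeros from 1 and
  \<open>zero_pos\<close> from 0.\<close>

definition limit_ray :: "(nat \<Rightarrow> nat) \<Rightarrow> (nat \<Rightarrow> nat \<Rightarrow> nat) \<Rightarrow> nat \<Rightarrow> nat" where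
  "limit_ray q a = ray (\<lambda>k. toeplitz q a (Suc k))"

lemma gen_word_eq_limit_ray:
  "gen_word q a n = map (limit_ray q a) [0..<length (gen_word q a n)]"
proof -
  let ?s = "\<lambda>k. toeplitz q a (Suc k)"
  have "Suc (height q n - 1) = height q n" by simp
  then have "[1..<height q n] = map Suc [0..<height q n - 1]"
    by (metis One_nat_def map_Suc_upt)
  then have "map (toeplitz q a) [1..<height q n] = map ?s [0..<height q n - 1]"
    by (simp add: comp_def)
  then have *: "gen_word q a n = map (limit_ray q a) [0..<Suc (zero_pos ?s (height q n - 1))]"
    by (simp only: gen_word_eq_word_of word_of_eq_ray limit_ray_def)
  then have "length (gen_word q a n) = Suc (zero_pos ?s (height q n - 1))" by simp
  with * show ?thesis by metis
qed

section \<open>Asymptotic points of a compact subshift\<close>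

abbreviation full_shift :: "(int \<Rightarrow> 'a) topology" where
  "full_shift \<equiv> product_topology (\<lambda>_. discrete_topology UNIV) UNIV"

lemma funpow_shift: "(shift ^^ n) x = (\<lambda>i. x (i + int n))"
  by (induction n) (simp_all add: shift_def fun_eq_iff add_ac)

section \<open>Convergence and compactness in the full shift\<close>

lemma limitin_discrete_topology:
  "limitin (discrete_topology UNIV) f l F \<longleftrightarrow> (\<forall>\<^sub>F n in F. f n = l)"
proof
  assume "limitin (discrete_topology UNIV) f l F"
  then have "openin (discrete_topology UNIV) {l} \<and> l \<in> {l} \<longrightarrow> (\<forall>\<^sub>F n in F. f n \<in> {l})"
    unfolding limitin_def by (rule conjunct2[THEN spec])
  then show "\<forall>\<^sub>F n in F. f n = l" by simp
next
  assume ev: "\<forall>\<^sub>F n in F. f n = l"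
  have "\<forall>\<^sub>F n in F. f n \<in> U" if "l \<in> U" for U
    using ev by eventually_elim (simp add: that)
  then show "limitin (discrete_topology UNIV) f l F" by (simp add: limitin_def)
qed

lemma limitin_full_shift:
  "limitin full_shift f l F \<longleftrightarrow> (\<forall>i. \<forall>\<^sub>F n in F. f n i = l i)"
  by (simp add: limitin_componentwise limitin_discrete_topology)

lemma openin_cylinder:
  assumes "finite K"
  shows "openin full_shift {y. \<forall>k\<in>K. y k = x k}"
proof -
  have "openin full_shift (\<Pi>\<^sub>E k\<in>UNIV. if k \<in> K then {x k} else UNIV)"
    by (rule product_topology_basis) (use assms in \<open>auto intro: finite_subset[of _ K]\<close>)
  moreover have "(\<Pi>\<^sub>E k\<in>UNIV. if k \<in> K then {x k} else UNIV) = {y. \<forall>k\<in>K. y k = x k}"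
    by (auto simp: PiE_def Pi_def extensional_def split: if_splits)
  ultimately show ?thesis by simp
qed

text \<open>A point outside the set is excluded by finitely many coordinates, so a cylinder around
  it avoids the set. The set is therefore closed in a compact product of copies of
  \<open>A\<close>.\<close>

lemma compactin_factor_closed:
  assumes "finite A"
  shows "compactin full_shift {x. range x \<subseteq> A \<and> (\<forall>i j. Q (map x [i..j]))}" (is "compactin _ ?X")
proof (rule closed_compactin)
  have "compactin (discrete_topology UNIV) A"
    by (rule finite_imp_compactin) (simp_all add: assms)
  then show "compactin full_shift (\<Pi>\<^sub>E k\<in>UNIV. A)" by (simp only: compactin_PiE) blast
  show "?X \<subseteq> (\<Pi>\<^sub>E k\<in>UNIV. A)" by (auto simp: PiE_def Pi_def)
  have open_cyl: "\<exists>T. openin full_shift T \<and> x \<in> T \<and> T \<subseteq> UNIV - ?X"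
    if "finite K" "\<And>y. (\<forall>k\<in>K. y k = x k) \<Longrightarrow> y \<notin> ?X" for x K
  proof (intro exI conjI)
    show "openin full_shift {y. \<forall>k\<in>K. y k = x k}" by (rule openin_cylinder[OF that(1)])
    show "{y. \<forall>k\<in>K. y k = x k} \<subseteq> UNIV - ?X" using that(2) by blast
  qed simp
  have "openin full_shift (UNIV - ?X)"
  proof (subst openin_subopen, intro ballI)
    fix x assume x: "x \<in> UNIV - ?X"
    show "\<exists>T. openin full_shift T \<and> x \<in> T \<and> T \<subseteq> UNIV - ?X"
    proof (cases "range x \<subseteq> A")
      case True
      with x obtain i j where Q: "\<not> Q (map x [i..j])" by blast
      show ?thesis
      proof (rule open_cyl)
        fix y assume "\<forall>k\<in>{i..j}. y k = x k"
        then have "map y [i..j] = map x [i..j]" by simp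
        then have "\<not> Q (map y [i..j])" using Q by (simp only: not_False_eq_True)
        then show "y \<notin> ?X" by blast
      qed simp
    next
      case False
      then obtain i where i: "x i \<notin> A" by blast
      show ?thesis
      proof (rule open_cyl)
        fix y assume "\<forall>k\<in>{i}. y k = x k"
        with i have "y i \<notin> A" by simp
        then show "y \<notin> ?X" by blast
      qed simp
    qed
  qed
  then show "closedin full_shift ?X" by (simp add: closedin_def)
qed

text \<open>The metric is known only through its topology, so sequential compactness supplies
  uniformity on \<open>X\<close>: closeness forces agreement at coordinate 0, and agreement from a
  coordinate far to the left onwards forces closeness.\<close>

lemma asymptotic_iff_eventually_equal:
  fixes X :: "(int \<Rightarrow> 'a) set"
  assumes "metric_on_subshift X d" "compactin full_shift X"
    and inv: "\<And>x. x \<in> X \<Longrightarrow> shift x \<in> X" and xy: "x \<in> X" "y \<in> X"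
  shows "asymptotic d shift x y \<longleftrightarrow> (\<exists>M. \<forall>i\<ge>M. x i = y i)"
proof -
  interpret Metric_space X d using assms(1) by (simp add: metric_on_subshift_def)
  have top: "mtopology = subtopology full_shift X"
    using assms(1) by (simp add: metric_on_subshift_def)
  have lim: "limitin mtopology f l sequentially \<longleftrightarrow>
      l \<in> X \<and> (\<forall>\<^sub>F n in sequentially. f n \<in> X) \<and> (\<forall>i. \<forall>\<^sub>F n in sequentially. f n i = l i)" for f l
    by (simp add: top limitin_subtopology limitin_full_shift)
  have "compactin mtopology X"
    using assms(2) by (simp add: top compactin_subtopology)
  then have seq: "\<exists>l r. l \<in> X \<and> strict_mono r \<and> limitin mtopology (u \<circ> r) l sequentially"
    if "\<And>n::nat. u n \<in> X" for u
    using that unfolding compactin_sequentially by blast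
  have pow: "(shift ^^ n) z \<in> X" if "z \<in> X" for n z
    using that inv by (induction n) auto
  \<comment> \<open>Otherwise pairs at distance tending to 0 differ at 0. Along a subsequence both
    members converge to the same limit, so both eventually have its value at 0.\<close>
  have A: "\<exists>\<delta>>0. \<forall>u\<in>X. \<forall>v\<in>X. d u v < \<delta> \<longrightarrow> u 0 = v 0"
  proof (rule ccontr)
    assume "\<not> ?thesis"
    moreover have "inverse (real (Suc n)) > 0" for n by simp
    ultimately have "\<exists>u v. u \<in> X \<and> v \<in> X \<and> d u v < inverse (real (Suc n)) \<and> u 0 \<noteq> v 0" for n
      by blast
    then obtain u v where uv: "\<And>n. u n \<in> X" "\<And>n. v n \<in> X"
      "\<And>n. d (u n) (v n) < inverse (real (Suc n))" "\<And>n. u n 0 \<noteq> v n 0"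
      by metis
    obtain l r where l: "l \<in> X" "strict_mono r" "limitin mtopology (u \<circ> r) l sequentially"
      using seq[of u] uv(1) by blast
    have d0: "(\<lambda>n. d (u n) (v n)) \<longlonglongrightarrow> 0"
      by (rule tendsto_sandwich[OF _ _ tendsto_const LIMSEQ_inverse_real_of_nat, rotated])
        (intro always_eventually allI less_imp_le uv(3), simp)
    have "(\<lambda>n. d (u (r n)) (v (r n)) + d (u (r n)) l) \<longlonglongrightarrow> 0 + 0"
      using LIMSEQ_subseq_LIMSEQ[OF d0 l(2)] l(3)
      by (intro tendsto_add) (auto simp: limitin_metric_dist_null o_def)
    then have upper: "(\<lambda>n. d (u (r n)) (v (r n)) + d (u (r n)) l) \<longlonglongrightarrow> 0" by simp
    have "(\<lambda>n. d (v (r n)) l) \<longlonglongrightarrow> 0"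
    proof (rule tendsto_sandwich[OF _ _ tendsto_const upper])
      show "\<forall>\<^sub>F n in sequentially. d (v (r n)) l \<le> d (u (r n)) (v (r n)) + d (u (r n)) l"
        using triangle''[of _ _ l] uv(1,2) l(1) by (intro always_eventually) blast
    qed simp_all
    then have "limitin mtopology (v \<circ> r) l sequentially"
      using uv(2) l(1) by (simp add: limitin_metric_dist_null)
    with l(3) have "\<forall>\<^sub>F n in sequentially. u (r n) 0 = l 0" "\<forall>\<^sub>F n in sequentially. v (r n) 0 = l 0"
      by (simp_all add: lim)
    then have "\<forall>\<^sub>F n in sequentially. False"
    proof eventually_elim
      case (elim n)
      with uv(4)[of "r n"] show ?case by simp
    qed
    then show False by simp
  qed
  \<comment> \<open>Otherwise some pairs stay \<open>\<epsilon>\<close> apart although they agree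
    from \<open>- int n\<close> on. Every coordinate eventually lies in the range of agreement, so
    along a subsequence both members have the same limit.\<close>
  have B: "\<exists>N::nat. \<forall>u\<in>X. \<forall>v\<in>X. (\<forall>i\<ge>- int N. u i = v i) \<longrightarrow> d u v < \<epsilon>" if "\<epsilon> > 0" for \<epsilon>
  proof (rule ccontr)
    assume "\<not> ?thesis"
    then have "\<exists>u v. u \<in> X \<and> v \<in> X \<and> (\<forall>i\<ge>- int n. u i = v i) \<and> \<not> d u v < \<epsilon>" for n
      by blast
    then obtain u v where uv: "\<And>n. u n \<in> X" "\<And>n. v n \<in> X"
      "\<And>n i. i \<ge> - int n \<Longrightarrow> u n i = v n i" "\<And>n. \<not> d (u n) (v n) < \<epsilon>"
      by metis
    obtain l r where l: "l \<in> X" "strict_mono r" "limitin mtopology (u \<circ> r) l sequentially"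
      using seq[of u] uv(1) by blast
    have "\<forall>\<^sub>F n in sequentially. v (r n) i = l i" for i
    proof -
      have "\<forall>\<^sub>F n in sequentially. u (r n) i = l i" using l(3) by (simp add: lim)
      moreover have "\<forall>\<^sub>F n in sequentially. nat \<bar>i\<bar> \<le> n" by (rule eventually_ge_at_top)
      ultimately show ?thesis
      proof eventually_elim
        case (elim n)
        have "n \<le> r n" using l(2) by (rule strict_mono_imp_increasing)
        with elim have "i \<ge> - int (r n)" by linarith
        with elim uv(3) show ?case by metis
      qed
    qed
    then have "limitin mtopology (v \<circ> r) l sequentially"
      using uv(2) l(1) by (simp add: lim)
    with l(3) have "(\<lambda>n. d (u (r n)) l + d (v (r n)) l) \<longlonglongrightarrow> 0 + 0"
      by (intro tendsto_add) (auto simp: limitin_metric_dist_null o_def)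
    then have "\<forall>\<^sub>F n in sequentially. d (u (r n)) l + d (v (r n)) l < \<epsilon>"
      using that by (intro order_tendstoD(2)) auto
    then obtain n where "d (u (r n)) l + d (v (r n)) l < \<epsilon>"
      by (auto simp: eventually_sequentially)
    moreover have "d (u (r n)) (v (r n)) \<le> d (u (r n)) l + d (v (r n)) l"
      using triangle[of "u (r n)" l "v (r n)"] uv(1,2) l(1) by (simp add: commute)
    ultimately show False using uv(4)[of "r n"] by linarith
  qed
  show ?thesis
  proof
    assume asym: "asymptotic d shift x y"
    obtain \<delta> where \<delta>: "\<delta> > 0" "\<And>u v. u \<in> X \<Longrightarrow> v \<in> X \<Longrightarrow> d u v < \<delta> \<Longrightarrow> u 0 = v 0"
      using A by blast
    have "\<forall>\<^sub>F n in sequentially. d ((shift ^^ n) x) ((shift ^^ n) y) < \<delta>"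
      using asym \<delta>(1) unfolding asymptotic_def by (rule order_tendstoD(2))
    then obtain N where "\<And>n. n \<ge> N \<Longrightarrow> d ((shift ^^ n) x) ((shift ^^ n) y) < \<delta>"
      by (auto simp: eventually_sequentially)
    then have "x (int n) = y (int n)" if "n \<ge> N" for n
      using \<delta>(2)[OF pow[OF xy(1)] pow[OF xy(2)], of n n] that by (simp add: funpow_shift)
    then have "x i = y i" if "i \<ge> int N" for i
      using that by (cases i) auto
    then show "\<exists>M. \<forall>i\<ge>M. x i = y i" by blast
  next
    assume "\<exists>M. \<forall>i\<ge>M. x i = y i"
    then obtain M where M: "\<And>i. i \<ge> M \<Longrightarrow> x i = y i" by blast
    show "asymptotic d shift x y"
      unfolding asymptotic_def
    proof (rule LIMSEQ_I)
      fix \<epsilon> :: real assume "\<epsilon> > 0"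
      then obtain N :: nat where N:
        "\<And>u v. u \<in> X \<Longrightarrow> v \<in> X \<Longrightarrow> (\<And>i. i \<ge> - int N \<Longrightarrow> u i = v i) \<Longrightarrow> d u v < \<epsilon>"
        using B by meson
      \<comment> \<open>After that many shifts the agreement starts at \<open>- int N\<close> or
        further left.\<close>
      have "d ((shift ^^ n) x) ((shift ^^ n) y) < \<epsilon>" if "n \<ge> nat M + N" for n
        by (rule N) (use that xy pow M in \<open>auto simp: funpow_shift\<close>)
      then show "\<exists>n0. \<forall>n\<ge>n0. norm (d ((shift ^^ n) x) ((shift ^^ n) y) - 0) < \<epsilon>"
        by auto
    qed
  qed
qed

text \<open>Negative iterates use the inverse of the restriction to \<open>X\<close>. Translation by
  \<open>- 1\<close> maps \<open>X\<close> into itself and is that inverse.\<close>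

lemma int_iterate_shift:
  assumes inv: "\<And>x k. x \<in> X \<Longrightarrow> (\<lambda>i. x (i + k)) \<in> X" and "x \<in> X"
  shows "int_iterate X shift k x = (\<lambda>i. x (i + k))"
proof (cases "0 \<le> k")
  case True
  then show ?thesis by (simp add: int_iterate_def funpow_shift)
next
  case False
  have inj: "inj_on shift X"
    by (auto simp: inj_on_def shift_def fun_eq_iff) (metis diff_add_cancel)
  have inv1: "inv_into X shift y = (\<lambda>i. y (i + - 1))" if "y \<in> X" for y
  proof (rule inv_into_f_eq[OF inj])
    show "(\<lambda>i. y (i + - 1)) \<in> X" using inv that by blast
  qed (simp add: shift_def)
  have "(inv_into X shift ^^ n) x = (\<lambda>i. x (i + - int n))" for n
  proof (induction n)
    case (Suc n)
    then show ?case using inv1[OF inv[OF assms(2), of "- int n"]] by (simp add: algebra_simps)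
  qed simp
  with False show ?thesis by (simp add: int_iterate_def)
qed

section \<open>One-sided structure of points\<close>

lemma map_upto_translate:
  fixes x y :: "int \<Rightarrow> 'a"
  assumes "\<And>m. i \<le> m \<Longrightarrow> m \<le> j \<Longrightarrow> y m = x (m + k)"
  shows "map y [i..j] = map x [i + k..j + k]"
  by (rule nth_equalityI) (use assms in \<open>auto simp: nth_upto algebra_simps\<close>)

lemma sublist_map_upto:
  assumes "l \<le> i" "j \<le> u"
  shows "sublist (map x [i..j]) (map x [l..u])"
proof (cases "i \<le> j")
  case True
  then have "[l..u] = [l..i - 1] @ [i..j] @ [j + 1..u]"
    using assms upto_split1[of l i u] upto_split2[of i j u] by simp
  then show ?thesis by (metis map_append sublist_appendI)
qed simp

locale ferenczi =
  fixes q :: "nat \<Rightarrow> nat" and a :: "nat \<Rightarrow> nat \<Rightarrow> nat" and C :: nat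
  assumes q_pos: "\<And>n. 1 \<le> q n"
    and spacer_le: "\<And>n i. i < q n \<Longrightarrow> a n i \<le> C"
    and aper: "aperiodic (ferenczi_subshift q a)"
begin

abbreviation X where "X \<equiv> ferenczi_subshift q a"
abbreviation R where "R \<equiv> limit_ray q a"
abbreviation U where "U \<equiv> toeplitz q a"
abbreviation h where "h \<equiv> height q"

lemma point_values: "x \<in> X \<Longrightarrow> x i \<in> {0, 1}"
  by (auto simp: ferenczi_subshift_def)

text \<open>The translation \<open>k\<close> may depend on the window, which admits limits of
  translates such as the periodic point in \<open>not_eventually_periodic\<close>.\<close>

lemma point_by_factors:
  assumes "x \<in> X" "range y \<subseteq> {0, 1}"
    and "\<And>i j. \<exists>k. \<forall>m\<in>{i..j}. y m = x (m + k)"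
  shows "y \<in> X"
proof -
  have "\<exists>n. sublist (map y [i..j]) (gen_word q a n)" for i j
  proof -
    obtain k where "\<forall>m\<in>{i..j}. y m = x (m + k)" using assms(3) by blast
    then have "map y [i..j] = map x [i + k..j + k]" by (intro map_upto_translate) auto
    moreover have "\<exists>n. sublist (map x [i + k..j + k]) (gen_word q a n)"
      using assms(1) by (auto simp: ferenczi_subshift_def)
    ultimately show ?thesis by simp
  qed
  with assms(2) show ?thesis by (simp add: ferenczi_subshift_def)
qed

lemma translate_mem: "x \<in> X \<Longrightarrow> (\<lambda>i. x (i + k)) \<in> X"
proof (rule point_by_factors[of x])
  assume "x \<in> X"
  then show "range (\<lambda>i. x (i + k)) \<subseteq> {0, 1}" by (intro image_subsetI point_values)
qed blast+

lemma shift_mem: "x \<in> X \<Longrightarrow> shift x \<in> X"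
  unfolding shift_def by (rule translate_mem)

section \<open>Windows, zeros and periods of points\<close>

lemma window_eq_ray:
  assumes "x \<in> X"
  obtains t where "\<And>j. j < n \<Longrightarrow> x (i + int j) = R (t + j)"
proof -
  let ?w = "map x [i..i + int n - 1]"
  obtain N where "sublist ?w (gen_word q a N)"
    using assms unfolding ferenczi_subshift_def by blast
  then obtain ps ss where w: "gen_word q a N = ps @ ?w @ ss" by (auto simp: sublist_def)
  have "x (i + int j) = R (length ps + j)" if "j < n" for j
  proof -
    have len: "length ps + j < length (gen_word q a N)" using w that by simp
    have "gen_word q a N ! (length ps + j) = x (i + int j)"
      using w that by (simp add: nth_append nth_upto)
    moreover have "gen_word q a N ! (length ps + j) = R (length ps + j)"
      using len by (subst gen_word_eq_limit_ray) (simp del: upt_Suc)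
    ultimately show ?thesis by simp
  qed
  then show thesis by (rule that)
qed

lemma zero_in_window:
  assumes "x \<in> X"
  obtains j where "i \<le> j" "j \<le> i + int C" "x j = 0"
proof -
  obtain t where t: "\<And>j. j < Suc C \<Longrightarrow> x (i + int j) = R (t + j)"
    using window_eq_ray[OF assms] by metis
  have "\<exists>k\<in>{t..t + C}. ray (\<lambda>k. U (Suc k)) k = 0"
    by (rule ray_zero_in_window) (rule toeplitz_le[OF q_pos spacer_le], simp_all)
  then obtain k where "k \<in> {t..t + C}" "R k = 0" unfolding limit_ray_def by blast
  with t[of "k - t"] show thesis by (intro that[of "i + int (k - t)"]) auto
qed

text \<open>Extending the period of the tail to both sides gives a shift-periodic sequence whose
  windows all occur far to the right in \<open>x\<close>. It lies in \<open>X\<close>, against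
  aperiodicity.\<close>

lemma not_eventually_periodic:
  assumes "x \<in> X" "0 < c" "\<And>i. M \<le> i \<Longrightarrow> x (i + int c) = x i"
  shows False
proof -
  have mult: "x (i + int c * int n) = x i" if "M \<le> i" for i n
  proof (induction n)
    case (Suc n)
    have "M \<le> i + int c * int n" using that by (simp add: add_increasing2)
    from assms(3)[OF this] Suc show ?case by (simp add: algebra_simps)
  qed simp
  define y where "y i = x (M + i mod int c)" for i
  have y: "y i = x (i + M + int c * k)" if "0 \<le> i + int c * k" for i k
  proof -
    have "i + int c * k = int c * ((i + int c * k) div int c) + i mod int c"
      using assms(2) by (metis mod_mult_self2 mult_div_mod_eq)
    moreover have nonneg: "0 \<le> (i + int c * k) div int c"
      using that assms(2) by (simp only: pos_imp_zdiv_nonneg_iff of_nat_0_less_iff)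
    moreover obtain n where "(i + int c * k) div int c = int n"
      using nonneg by (rule nonneg_int_cases)
    ultimately have eq: "i + M + int c * k = M + i mod int c + int c * int n" by simp
    have "M \<le> M + i mod int c" using assms(2) by simp
    from mult[OF this] show ?thesis by (simp only: y_def eq)
  qed
  have "y \<in> X"
  proof (rule point_by_factors[OF assms(1)])
    show "range y \<subseteq> {0, 1}" unfolding y_def by (intro image_subsetI point_values assms(1))
    fix i j :: int
    \<comment> \<open>Translating by a multiple of \<open>c\<close> keeps the residue, and
      \<open>\<bar>i\<bar>\<close> periods push the window into the periodic tail.\<close>
    have "y m = x (m + (M + int c * \<bar>i\<bar>))" if "m \<in> {i..j}" for m
    proof -
      have "1 * \<bar>i\<bar> \<le> int c * \<bar>i\<bar>" using assms(2) by (intro mult_right_mono) simp_all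
      moreover have "i \<le> m" using that by simp
      ultimately have "0 \<le> m + int c * \<bar>i\<bar>" by linarith
      from y[OF this] show ?thesis by (simp only: add.assoc)
    qed
    then show "\<exists>k. \<forall>m\<in>{i..j}. y m = x (m + k)" by blast
  qed
  moreover have "(shift ^^ c) y = y" by (simp add: funpow_shift fun_eq_iff y_def)
  ultimately show False using aper assms(2) unfolding aperiodic_def by blast
qed

text \<open>Every window of \<open>x\<close> is copied from the limit ray, where the number of the
  starting zero modulo \<open>h n\<close> gives a phase. There are finitely many phases, so one of
  them works for all window lengths.\<close>

lemma phase:
  assumes "x \<in> X" "\<And>i. x (p + int i) = ray s i"
  obtains z where "z < h n" "\<And>k. \<not> h n dvd k + z \<Longrightarrow> s k = U ((k + z) mod h n)"
proof -
  have upto_L: "\<exists>z<h n. \<forall>k\<le>L. \<not> h n dvd k + z \<longrightarrow> s k = U ((k + z) mod h n)" for L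
  proof -
    let ?v = "\<lambda>k. U (Suc k)"
    obtain t where t: "\<And>j. j < Suc (zero_pos s (Suc L)) \<Longrightarrow> x (p + int j) = R (t + j)"
      using window_eq_ray[OF assms(1)] by metis
    then have match: "ray s j = ray ?v (t + j)" if "j \<le> zero_pos s (Suc L)" for j
      using that assms(2)[of j] by (simp add: limit_ray_def)
    have "ray ?v t = 0" using match[of 0] ray_zero_pos[of s 0] by simp
    then obtain z where z: "t = zero_pos ?v z" by (auto simp: ray_eq_0_iff)
    \<comment> \<open>The phase is \<open>Suc z\<close> because gap number \<open>z\<close> of the
      limit ray is \<open>U (Suc z)\<close>.\<close>
    show ?thesis
    proof (intro exI[of _ "Suc z mod h n"] conjI allI impI)
      fix k assume k: "k \<le> L" "\<not> h n dvd k + Suc z mod h n"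
      have "s k = ?v (z + k)"
        by (rule ray_match[where L = "zero_pos s (Suc L)"])
          (use match z k(1) in \<open>auto simp del: zero_pos_Suc\<close>)
      moreover have eq: "(k + Suc z mod h n) mod h n = (k + Suc z) mod h n"
        by (simp add: mod_add_right_eq)
      moreover have "\<not> h n dvd k + Suc z"
        using k(2) eq by (simp add: dvd_eq_mod_eq_0)
      ultimately show "s k = U ((k + Suc z mod h n) mod h n)"
        using toeplitz_mod[of q n "k + Suc z" a] by (simp add: add.commute)
    qed simp
  qed
  have "\<exists>z<h n. \<forall>k. \<not> h n dvd k + z \<longrightarrow> s k = U ((k + z) mod h n)"
  proof (rule ccontr)
    assume "\<not> ?thesis"
    then have "\<forall>z\<in>{..<h n}. \<exists>k. \<not> (\<not> h n dvd k + z \<longrightarrow> s k = U ((k + z) mod h n))" by blast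
    \<comment> \<open>If each phase \<open>z\<close> fails at an index \<open>b z\<close>, then all
      of them fail up to the sum of these indices, contrary to \<open>upto_L\<close>.\<close>
    then obtain b where b: "\<And>z. z < h n \<Longrightarrow> \<not> (\<not> h n dvd b z + z \<longrightarrow> s (b z) = U ((b z + z) mod h n))"
      unfolding bchoice_iff by auto
    obtain z where "z < h n" "\<forall>k\<le>sum b {..<h n}. \<not> h n dvd k + z \<longrightarrow> s k = U ((k + z) mod h n)"
      using upto_L by blast
    moreover from this have "b z \<le> sum b {..<h n}" by (intro member_le_sum) auto
    ultimately show False using b by blast
  qed
  then show thesis using that by blast
qed

text \<open>Two distinct phases have no common hole, so together they force a period.\<close>

lemma phase_unique:
  assumes "x \<in> X" "\<And>i. x (p + int i) = ray s i" "z < h n" "z' < h n"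
    and z: "\<And>k. 1 \<le> k \<Longrightarrow> \<not> h n dvd k + z \<Longrightarrow> s k = U ((k + z) mod h n)"
    and z': "\<And>k. 1 \<le> k \<Longrightarrow> \<not> h n dvd k + z' \<Longrightarrow> s k = U ((k + z') mod h n)"
  shows "z = z'"
proof (rule ccontr)
  assume ne: "z \<noteq> z'"
  \<comment> \<open>Index 0 is left out so that the lemma covers phases of two gap sequences that
    agree only from index 1 on.\<close>
  have "s (k + h n) = s k" if "1 \<le> k" for k
  proof -
    have shift_dvd: "h n dvd k + h n + w \<longleftrightarrow> h n dvd k + w" for w
      by (metis add.assoc add.commute dvd_add_triv_left_iff)
    have shift_mod: "(k + h n + w) mod h n = (k + w) mod h n" for w
      by (metis add.assoc add.commute mod_add_self2)
    have "\<not> (h n dvd k + z \<and> h n dvd k + z')"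
    proof
      assume "h n dvd k + z \<and> h n dvd k + z'"
      then have "(k + z) mod h n = (k + z') mod h n" by (simp add: dvd_eq_mod_eq_0)
      then have "z mod h n = z' mod h n" 
        by (simp add: nat_mod_eq_iff)
      with ne assms(3,4) show False by simp
    qed
    then show ?thesis
      using z[of k] z[of "k + h n"] z'[of k] z'[of "k + h n"] that
      unfolding shift_dvd shift_mod by auto
  qed
  then obtain c M where c: "0 < c" "\<And>i. M \<le> i \<Longrightarrow> ray s (i + c) = ray s i"
    using ray_eventually_periodic[of 1 s "h n"] height_pos by metis
  have "x (i + int c) = x i" if "p + int M \<le> i" for i
  proof -
    have "M \<le> nat (i - p)" "i = p + int (nat (i - p))" "i + int c = p + int (nat (i - p) + c)"
      using that by auto
    then show ?thesis using c(2) assms(2) by metis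
  qed
  then show False using not_eventually_periodic[OF assms(1) c(1)] by blast
qed

section \<open>Distinct points that agree on a right ray\<close>

lemma spacers_to_right:
  assumes "x \<in> X" "x p = 0"
  obtains s where "\<And>i. x (p + int i) = ray s i"
proof -
  have "\<exists>j\<ge>i. x (p + int j) = 0" for i
  proof -
    obtain j where "p + int i \<le> j" "x j = 0" using zero_in_window[OF assms(1)] by metis
    then show ?thesis by (intro exI[of _ "nat (j - p)"]) auto
  qed
  then obtain s where "(\<lambda>i. x (p + int i)) = ray s"
  proof (rule exists_spacer_sequence[rotated 2])
    show "range (\<lambda>i. x (p + int i)) \<subseteq> {0, 1}" by (intro image_subsetI point_values assms(1))
  qed (use assms(2) in simp_all)
  then show thesis using that by metis
qed

lemma last_zero_before:
  assumes "x \<in> X"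
  obtains p where "p < i" "x p = 0" "\<And>j. p < j \<Longrightarrow> j < i \<Longrightarrow> x j = 1"
proof -
  obtain j where j: "i - 1 - int C \<le> j" "j \<le> i - 1 - int C + int C" "x j = 0"
    using zero_in_window[OF assms] by metis
  define S where "S = {k. j \<le> k \<and> k < i \<and> x k = 0}"
  have fin: "finite S" unfolding S_def by (rule finite_subset[of _ "{j..i}"]) auto
  have "j \<in> S" using j by (simp add: S_def)
  then have m: "Max S \<in> S" using fin Max_in by blast
  have "x k = 1" if "Max S < k" "k < i" for k
  proof -
    have "k \<notin> S" using that(1) fin Max_ge leD by blast
    moreover have "j \<le> k" using m that(1) by (simp add: S_def)
    ultimately show ?thesis using that(2) point_values[OF assms, of k] by (auto simp: S_def)
  qed
  moreover have "Max S < i" "x (Max S) = 0" using m unfolding S_def by blast+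
  ultimately show thesis using that by blast
qed

text \<open>The gap sequences of \<open>x\<close> and \<open>y\<close> differ at index \<open>0\<close> only, so index \<open>0\<close> is a hole at every
  level, which determines all later gaps.\<close>

lemma common_tail_aux:
  assumes x: "x \<in> X" and y: "y \<in> X" and eq: "\<And>i. m \<le> i \<Longrightarrow> x i = y i"
    and xm: "x (m - 1) = 0" and ym: "y (m - 1) = 1"
  obtains c where "m \<le> c" "\<And>i. x (c + int i) = R i"
proof -
  obtain s where s: "\<And>i. x (m - 1 + int i) = ray s i"
    using spacers_to_right[OF x xm] by metis
  obtain p where p: "p < m" "y p = 0" "\<And>j. p < j \<Longrightarrow> j < m \<Longrightarrow> y j = 1"
    using last_zero_before[OF y] by metis
  have pm: "p < m - 1" using p(1,2) ym by (cases "p = m - 1") auto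
  obtain s' where s': "\<And>i. y (p + int i) = ray s' i"
    using spacers_to_right[OF y p(2)] by metis
  \<comment> \<open>The gap at index 0 starts at \<open>m - 1\<close> in \<open>x\<close>, and
    \<open>e\<close> places earlier, at the zero \<open>p\<close>, in \<open>y\<close>.\<close>
  define e where "e = nat (m - 1 - p)"
  have e: "0 < e" "p + int e = m - 1" using pm by (auto simp: e_def)
  have xs: "ray s (Suc i) = ray s' (e + Suc i)" for i
    using s[of "Suc i"] s'[of "e + Suc i"] eq[of "m + int i"] e(2)
    by (simp add: algebra_simps) (metis add.commute add.left_commute add_diff_cancel_left')
  \<comment> \<open>Both gaps end at the same zero: \<open>y\<close> has no zero strictly between
    \<open>p\<close> and \<open>m\<close>, and from \<open>m\<close> on the points agree.\<close>
  have first: "zero_pos s' 1 = e + zero_pos s 1"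
  proof -
    have "ray s' (e + Suc (s 0)) = 0"
      using xs[of "s 0"] ray_zero_pos[of s 1] by simp
    then obtain j where j: "e + Suc (s 0) = zero_pos s' j" by (auto simp: ray_eq_0_iff)
    then have "1 \<le> j" by (cases j) auto
    then have le: "Suc (s' 0) \<le> e + Suc (s 0)" using j zero_pos_le_iff[of s' 1 j] by simp
    have "ray s' (Suc (s' 0)) = 0" using ray_zero_pos[of s' 1] by simp
    have "\<not> Suc (s' 0) \<le> e"
    proof
      assume "Suc (s' 0) \<le> e"
      then have "y (p + int (Suc (s' 0))) = 1" using p(3) e by force
      with s'[of "Suc (s' 0)"] \<open>ray s' (Suc (s' 0)) = 0\<close> show False by simp
    qed
    then obtain i where i: "Suc (s' 0) = e + Suc i" by (metis add_Suc_right less_imp_Suc_add not_le)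
    then have "ray s (Suc i) = 0" using xs \<open>ray s' (Suc (s' 0)) = 0\<close> by metis
    then obtain j where j: "Suc i = zero_pos s j" by (auto simp: ray_eq_0_iff)
    then have "1 \<le> j" by (cases j) auto
    then have "Suc (s 0) \<le> Suc i" using j zero_pos_le_iff[of s 1 j] by simp
    with i le show ?thesis by simp
  qed
  have same: "s k = s' k" if "1 \<le> k" for k
  proof -
    have "ray (\<lambda>k. s (Suc k)) i = ray (\<lambda>k. s' (Suc k)) (zero_pos (\<lambda>k. s' (Suc k)) 0 + i)" for i
    proof -
      have "ray (\<lambda>k. s (Suc k)) i = ray s (Suc (s 0) + i)" by (rule ray_Suc_shift[symmetric])
      also have "\<dots> = ray s' (e + Suc (s 0) + i)" using xs[of "s 0 + i"] by (simp add: algebra_simps)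
      also have "\<dots> = ray s' (Suc (s' 0) + i)" using first by simp
      also have "\<dots> = ray (\<lambda>k. s' (Suc k)) i" by (rule ray_Suc_shift)
      finally show ?thesis by simp
    qed
    then have "s (Suc j) = s' (Suc (0 + j))" for j
      using ray_match[of "zero_pos (\<lambda>k. s (Suc k)) (Suc j)" "\<lambda>k. s (Suc k)" "\<lambda>k. s' (Suc k)" 0 j]
      by simp
    with that show ?thesis by (cases k) auto
  qed
  have ne: "s 0 \<noteq> s' 0" using first e(1) by simp
  have hole: "s k = U (k mod h n)" if "\<not> h n dvd k" for n k
  proof -
    obtain z where z: "z < h n" "\<And>k. \<not> h n dvd k + z \<Longrightarrow> s k = U ((k + z) mod h n)"
      using phase[OF x s] by metis
    obtain z' where z': "z' < h n" "\<And>k. \<not> h n dvd k + z' \<Longrightarrow> s' k = U ((k + z') mod h n)"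
      using phase[OF y s'] by metis
    have "z = z'"
      by (rule phase_unique[OF x s z(1) z'(1)]) (use z(2) z'(2) same in auto)
    \<comment> \<open>If index 0 were not a hole, the common phase would give both points the same
      gap there.\<close>
    then have "h n dvd z" using z(2)[of 0] z'(2)[of 0] ne by (metis add_0)
    then have "z = 0" using z(1) nat_dvd_not_less by blast
    with z(2)[of k] that show ?thesis by simp
  qed
  \<comment> \<open>The level may depend on the index; level \<open>k\<close> serves because
    \<open>k < h k\<close>.\<close>
  have "s k = U k" if "1 \<le> k" for k
  proof -
    have "k < h k" by (rule less_height[OF q_pos])
    with hole[of k k] that show ?thesis by (simp add: nat_dvd_not_less)
  qed
  then have R: "R = ray (\<lambda>k. s (Suc k))" by (simp add: limit_ray_def)
  show thesis
  proof
    show "m \<le> m + int (s 0)" by simp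
    fix i
    have "x (m + int (s 0) + int i) = x (m - 1 + int (Suc (s 0) + i))" by (simp add: algebra_simps)
    then show "x (m + int (s 0) + int i) = R i" using s R ray_Suc_shift by metis
  qed
qed

lemma common_tail:
  assumes x: "x \<in> X" and y: "y \<in> X" and eq: "\<And>i. m \<le> i \<Longrightarrow> x i = y i" and "x \<noteq> y"
  obtains c where "\<And>i. x (c + int i) = R i"
proof -
  obtain j where j: "x j \<noteq> y j" using assms(4) by blast
  then have jm: "j < m" using eq[of j] by force
  \<comment> \<open>The rightmost disagreement puts the pair into the situation of
    \<open>common_tail_aux\<close>, up to exchanging the two points.\<close>
  define S where "S = {k. j \<le> k \<and> k < m \<and> x k \<noteq> y k}"
  have fin: "finite S" unfolding S_def by (rule finite_subset[of _ "{j..m}"]) auto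
  have "j \<in> S" using j jm by (simp add: S_def)
  then have M: "Max S \<in> S" using fin Max_in by blast
  let ?m = "Max S + 1"
  have eq': "x k = y k" if "?m \<le> k" for k
  proof (rule ccontr)
    assume "x k \<noteq> y k"
    moreover from this have "k < m" using eq[of k] by force
    ultimately have "k \<in> S" using M that by (simp add: S_def)
    with that Max_ge[OF fin this] show False by simp
  qed
  have "x (?m - 1) \<noteq> y (?m - 1)" using M by (simp add: S_def)
  then consider "x (?m - 1) = 0" "y (?m - 1) = 1" | "y (?m - 1) = 0" "x (?m - 1) = 1"
    using point_values[OF x, of "?m - 1"] point_values[OF y, of "?m - 1"] by fastforce
  then show thesis
  proof cases
    case 1
    then show ?thesis using common_tail_aux[OF x y eq'] that by metis
  next
    case 2
    have "y k = x k" if "?m \<le> k" for k using eq'[OF that] by simp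
    then obtain c where "?m \<le> c" "\<And>i. y (c + int i) = R i"
      using common_tail_aux[OF y x _ 2] by metis
    then show ?thesis using eq' by (intro that[of c]) simp
  qed
qed

section \<open>The points with a hole\<close>

lemma gen_word_Suc_suffix:
  obtains u where "gen_word q a (Suc n) = u @ gen_word q a n" "u \<noteq> []"
proof -
  have "[0..<q n] = 0 # [1..<q n]" using q_pos[of n] upt_conv_Cons[of 0 "q n"] by simp
  moreover have "gen_word q a n \<noteq> []" for n
    by (induction n) simp_all
  ultimately show thesis by (intro that[OF gen_word.simps(2)]) simp
qed

lemma length_gen_word: "n < length (gen_word q a n)"
proof (induction n)
  case (Suc n)
  obtain u where "gen_word q a (Suc n) = u @ gen_word q a n" "u \<noteq> []"
    by (rule gen_word_Suc_suffix)
  with Suc show ?case by (cases u) (simp_all del: gen_word.simps)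
qed simp

lemma gen_word_suffix: "m \<le> n \<Longrightarrow> \<exists>u. gen_word q a n = u @ gen_word q a m"
proof (induction n rule: dec_induct)
  case (step n)
  obtain u where "gen_word q a (Suc n) = u @ gen_word q a n" by (rule gen_word_Suc_suffix)
  with step.IH show ?case by (metis append.assoc)
qed simp

text \<open>Each generating word is a suffix of the later ones, so read from right to left they have
  a limit. Level \<open>j\<close> suffices for letter \<open>j\<close> since
  \<open>gen_word q a j\<close> has more than \<open>j\<close> letters.\<close>

definition left_ray :: "nat \<Rightarrow> nat" where
  "left_ray j = rev (gen_word q a j) ! j"

lemma left_ray_eq:
  assumes "j < length (gen_word q a n)"
  shows "left_ray j = rev (gen_word q a n) ! j"
proof -
  have eq: "rev (gen_word q a l) ! j = rev (gen_word q a m) ! j"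
    if "m \<le> l" "j < length (gen_word q a m)" for l m
  proof -
    obtain u where "gen_word q a l = u @ gen_word q a m"
      using gen_word_suffix[OF \<open>m \<le> l\<close>] by blast
    with \<open>j < length (gen_word q a m)\<close> show ?thesis by (simp add: nth_append)
  qed
  show ?thesis
    using eq[of j n] eq[of n j] assms length_gen_word[of j]
    by (cases "j \<le> n") (simp_all add: left_ray_def)
qed

text \<open>The point \<open>\<dots> w\<^sub>n 1\<^sup>v . w\<^sub>n \<dots>\<close>, with the dot to the left of position \<open>0\<close>.\<close>

definition hole_point :: "nat \<Rightarrow> int \<Rightarrow> nat" where
  "hole_point v i =
     (if 0 \<le> i then R (nat i) else if - int v \<le> i then 1 else left_ray (nat (- i - 1) - v))"

definition recurrent_spacer :: "nat \<Rightarrow> bool" where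
  "recurrent_spacer v \<longleftrightarrow> (\<forall>N. \<exists>n\<ge>N. \<exists>i<q n. a n i = v)"

lemma hole_point_window:
  fixes n :: nat
  defines "w \<equiv> gen_word q a n"
  shows "map (hole_point v) [- int (length w + v)..int (length w) - 1] = w @ replicate v 1 @ w"
proof (rule nth_equalityI)
  fix t assume "t < length (map (hole_point v) [- int (length w + v)..int (length w) - 1])"
  then have t: "t < length w + v + length w" by simp
  have nth: "map (hole_point v) [- int (length w + v)..int (length w) - 1] ! t =
      hole_point v (int t - int (length w + v))"
    using t by (simp add: nth_upto algebra_simps)
  consider "t < length w" | "length w \<le> t" "t < length w + v" | "length w + v \<le> t" by linarith
  then have "hole_point v (int t - int (length w + v)) = (w @ replicate v 1 @ w) ! t"
  proof cases
    case 1
    have "nat (- (int t - int (length w + v)) - 1) - v = length w - Suc t" using 1 by linarith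
    then have "hole_point v (int t - int (length w + v)) = left_ray (length w - Suc t)"
      using 1 by (simp add: hole_point_def)
    also have "\<dots> = rev w ! (length w - Suc t)"
      using 1 unfolding w_def by (intro left_ray_eq) simp
    also have "\<dots> = w ! t" using 1 by (simp add: rev_nth)
    finally show ?thesis using 1 by (simp add: nth_append)
  next
    case 2
    moreover from this have "t - length w < v" by linarith
    ultimately show ?thesis by (simp add: hole_point_def nth_append)
  next
    case 3
    define k where "k = t - (length w + v)"
    have k: "t = length w + v + k" "k < length w" using 3 t by (simp_all add: k_def)
    have "w ! k = R k"
      using k(2) unfolding w_def by (subst gen_word_eq_limit_ray) (simp del: upt_Suc)
    then show ?thesis using k by (simp add: hole_point_def nth_append)
  qed
  with nth show "map (hole_point v) [- int (length w + v)..int (length w) - 1] ! t =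
      (w @ replicate v 1 @ w) ! t" by simp
qed simp

lemma sublist_gen_word_Suc:
  assumes "i < q n"
  shows "sublist (gen_word q a n @ replicate (a n i) 1 @ gen_word q a n) (gen_word q a (Suc n))"
proof -
  let ?f = "\<lambda>i. gen_word q a n @ replicate (a n i) 1"
  have "[0..<q n] = [0..<i] @ i # [Suc i..<q n]"
    using assms upt_add_eq_append[of 0 i "q n - i"] upt_conv_Cons[of i "q n"] by simp
  then have "gen_word q a (Suc n) =
      concat (map ?f [0..<i]) @ gen_word q a n @ replicate (a n i) 1 @
      (concat (map ?f [Suc i..<q n]) @ gen_word q a n)"
    by simp
  \<comment> \<open>The spacer is followed by a copy of the word in any case: the next one in the
    concatenation or the final one.\<close>
  moreover obtain u where "concat (map ?f [Suc i..<q n]) @ gen_word q a n = gen_word q a n @ u"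
    by (cases "[Suc i..<q n]") auto
  ultimately have "gen_word q a (Suc n) = concat (map ?f [0..<i]) @
      (gen_word q a n @ replicate (a n i) 1 @ gen_word q a n) @ u"
    by (simp only: append.assoc)
  then show ?thesis by (metis sublist_appendI)
qed

text \<open>The factors \<open>w\<^sub>n 1\<^sup>v w\<^sub>n\<close> exhaust the point, and they
  occur in the next generating word whenever \<open>v\<close> is a spacer of level \<open>n\<close>,
  hence for arbitrarily large \<open>n\<close>.\<close>

lemma hole_point_mem:
  assumes "recurrent_spacer v"
  shows "hole_point v \<in> X"
proof -
  have "R i \<in> {0, 1}" for i unfolding limit_ray_def by (rule ray_values)
  moreover have "set (gen_word q a n) \<subseteq> {0, 1}" for n
    by (subst gen_word_eq_limit_ray, unfold set_map limit_ray_def) (intro image_subsetI ray_values)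
  then have "left_ray i \<in> {0, 1}" for i
    using length_gen_word[of i] unfolding left_ray_def by (metis length_rev nth_mem set_rev subsetD)
  ultimately have "range (hole_point v) \<subseteq> {0, 1}"
    unfolding hole_point_def by (intro image_subsetI) (simp split: if_split)
  moreover have "\<exists>n. sublist (map (hole_point v) [i..j]) (gen_word q a n)" for i j
  proof -
    obtain n l where n: "nat (\<bar>i\<bar> + \<bar>j\<bar>) \<le> n" "l < q n" "a n l = v"
      using assms unfolding recurrent_spacer_def by blast
    let ?w = "gen_word q a n"
    have "\<bar>i\<bar> + \<bar>j\<bar> < int (length ?w)" using n(1) length_gen_word[of n] by linarith
    then have "sublist (map (hole_point v) [i..j])
        (map (hole_point v) [- int (length ?w + v)..int (length ?w) - 1])"
      by (intro sublist_map_upto) linarith+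
    then have "sublist (map (hole_point v) [i..j]) (?w @ replicate v 1 @ ?w)"
      by (simp only: hole_point_window)
    with sublist_gen_word_Suc[OF n(2)] n(3) show ?thesis by (blast intro: sublist_order.order.trans)
  qed
  ultimately show ?thesis by (simp add: ferenczi_subshift_def)
qed

lemma hole_point_right: "hole_point v (int i) = R i"
  by (simp add: hole_point_def)

text \<open>Both points carry the limit ray from 0 on, so a translation by
  \<open>k \<noteq> 0\<close> would make a point of \<open>X\<close> eventually periodic. For
  \<open>k = 0\<close>, the longer gap still has a one where the shorter gap is preceded by a
  zero.\<close>

lemma hole_points_not_translates:
  assumes v: "recurrent_spacer v" and "v \<noteq> v'"
  shows "hole_point v' \<noteq> (\<lambda>i. hole_point v (i + k))"
proof
  let ?x = "hole_point v"
  assume eq: "hole_point v' = (\<lambda>i. ?x (i + k))"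
  have per: "?x (i + k) = ?x i" if "0 \<le> i" for i
    using fun_cong[OF eq, of i] that by (simp add: hole_point_def)
  consider "0 < k" | "k < 0" | "k = 0" by linarith
  then show False
  proof cases
    case 1
    then show ?thesis using not_eventually_periodic[OF hole_point_mem[OF v], of "nat k" 0] per by simp
  next
    case 2
    have "?x (i + int (nat (- k))) = ?x i" if "- k \<le> i" for i
      using per[of "i - k"] 2 that by simp
    then show ?thesis
      using not_eventually_periodic[OF hole_point_mem[OF v], of "nat (- k)" "- k"] 2 by simp
  next
    case 3
    have neq: "hole_point u \<noteq> hole_point u'" if "u < u'" for u u'
    proof
      assume "hole_point u = hole_point u'"
      moreover have "hole_point u (- int u - 1) = 0"
        by (simp add: hole_point_def left_ray_def)
      moreover have "hole_point u' (- int u - 1) = 1"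
        using that by (simp add: hole_point_def)
      ultimately show False by simp
    qed
    have "hole_point v' = hole_point v" using eq 3 by simp
    then show ?thesis using neq[of v v'] neq[of v' v] assms(2) by (metis linorder_neqE_nat)
  qed
qed

text \<open>If a single spacer recurs, then all holes of a high level are filled with it and the limit is
  periodic.\<close>

lemma two_recurrent_spacers:
  obtains v v' where "recurrent_spacer v" "recurrent_spacer v'" "v \<noteq> v'"
proof -
  \<comment> \<open>Each of the finitely many values up to \<open>C\<close> that does not recur
    disappears from some level on; the sum of these levels bounds them all.\<close>
  have "\<exists>N. \<forall>v\<le>C. \<not> recurrent_spacer v \<longrightarrow> (\<forall>n\<ge>N. \<forall>i<q n. a n i \<noteq> v)"
  proof -
    have "\<forall>v. \<exists>N. \<not> recurrent_spacer v \<longrightarrow> (\<forall>n\<ge>N. \<forall>i<q n. a n i \<noteq> v)"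
      unfolding recurrent_spacer_def by blast
    then obtain N where N: "\<And>v. \<not> recurrent_spacer v \<Longrightarrow> \<forall>n\<ge>N v. \<forall>i<q n. a n i \<noteq> v"
      by metis
    have "N v \<le> sum N {..C}" if "v \<le> C" for v using that by (intro member_le_sum) auto
    with N show ?thesis by (metis order_trans)
  qed
  then obtain N where N: "\<And>v n i. v \<le> C \<Longrightarrow> \<not> recurrent_spacer v \<Longrightarrow> N \<le> n \<Longrightarrow> i < q n \<Longrightarrow> a n i \<noteq> v"
    by blast
  have rec: "recurrent_spacer (a n i)" if "N \<le> n" "i < q n" for n i
    using N[OF spacer_le[OF that(2)] _ that] by blast
  define v where "v = a N 0"
  have v: "recurrent_spacer v" using rec[of N 0] q_pos[of N] by (simp add: v_def)
  have "\<exists>v'. recurrent_spacer v' \<and> v' \<noteq> v"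
  proof (rule ccontr)
    assume "\<not> ?thesis"
    then have const: "a n i = v" if "N \<le> n" "i < q n" for n i using rec that by blast
    have hole: "U k = v" if dvd: "h N dvd k" and pos: "0 < k" for k
    proof -
      obtain l i where l: "i < q l" "U k = a l i" "\<not> h (Suc l) dvd k"
        by (rule toeplitz_is_spacer[OF q_pos pos])
      \<comment> \<open>Otherwise \<open>h (Suc l)\<close> would divide \<open>h N\<close> and hence
        \<open>k\<close>.\<close>
      have "N \<le> l"
        using l(3) dvd height_dvd[of "Suc l" N q] by (meson dvd_trans not_less_eq_eq)
      with l(1,2) const show ?thesis by simp
    qed
    \<comment> \<open>Multiples of \<open>h N\<close> all carry \<open>v\<close>, and elsewhere the
      value depends only on the residue.\<close>
    have "U (Suc (k + h N)) = U (Suc k)" for k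
    proof (cases "h N dvd Suc k")
      case True
      moreover from this have "h N dvd Suc (k + h N)" by (metis add_Suc dvd_add_triv_right_iff)
      ultimately show ?thesis using hole by simp
    next
      case False
      moreover from this have "\<not> h N dvd Suc (k + h N)" by (metis add_Suc dvd_add_triv_right_iff)
      ultimately show ?thesis
        using toeplitz_mod[of q N "Suc k" a] toeplitz_mod[of q N "Suc (k + h N)" a]
        by (metis add_Suc mod_add_self2)
    qed
    then obtain c M where c: "0 < c" "\<And>i. M \<le> i \<Longrightarrow> R (i + c) = R i"
      unfolding limit_ray_def
      using ray_eventually_periodic[of 0 "\<lambda>k. U (Suc k)" "h N"] height_pos by metis
    have "hole_point v (i + int c) = hole_point v i" if "int M \<le> i" for i
    proof -
      have "i = int (nat i)" "i + int c = int (nat i + c)" "M \<le> nat i" using that by auto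
      then show ?thesis using c(2) hole_point_right by metis
    qed
    then show False using not_eventually_periodic[OF hole_point_mem[OF v] c(1)] by blast
  qed
  with v show thesis using that by blast
qed

section \<open>Asymptotic classes\<close>

lemma compact_X: "compactin full_shift X"
  unfolding ferenczi_subshift_def by (rule compactin_factor_closed) simp

text \<open>Compactness of \<open>X\<close> removes the metric from the relation and leaves
  agreement of right tails up to translation.\<close>

lemma asymptotic_rel_iff:
  assumes "metric_on_subshift X d"
  shows "(x, y) \<in> asymptotic_rel X d shift \<longleftrightarrow>
    x \<in> X \<and> y \<in> X \<and> (\<exists>k M. \<forall>i\<ge>M. x i = y (i + k))"
proof -
  have "asymptotic d shift x (int_iterate X shift k y) \<longleftrightarrow> (\<exists>M. \<forall>i\<ge>M. x i = y (i + k))"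
    if "x \<in> X" "y \<in> X" for k
  proof -
    have "int_iterate X shift k y = (\<lambda>i. y (i + k))"
      by (rule int_iterate_shift) (simp_all add: translate_mem that)
    then show ?thesis
      using asymptotic_iff_eventually_equal[OF assms compact_X shift_mem that(1) translate_mem[OF that(2)]]
      by (simp only:)
  qed
  then show ?thesis unfolding asymptotic_rel_def by blast
qed

lemma equiv_asymptotic_rel:
  assumes "metric_on_subshift X d"
  shows "equiv X (asymptotic_rel X d shift)"
proof (rule equivI)
  show "asymptotic_rel X d shift \<subseteq> X \<times> X" by (auto simp: asymptotic_rel_def)
  show "refl_on X (asymptotic_rel X d shift)"
  proof (rule refl_onI)
    fix x assume "x \<in> X"
    moreover have "\<forall>i\<ge>0. x i = x (i + 0)" by simp
    ultimately show "(x, x) \<in> asymptotic_rel X d shift"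
      unfolding asymptotic_rel_iff[OF assms] by blast
  qed
  show "sym (asymptotic_rel X d shift)"
  proof (rule symI, unfold asymptotic_rel_iff[OF assms], elim conjE exE, intro conjI)
    fix x y and k M :: int assume eq: "\<forall>i\<ge>M. x i = y (i + k)"
    have "y i = x (i + - k)" if "M + k \<le> i" for i :: int
      using eq[rule_format, of "i - k"] that by simp
    then show "\<exists>k M. \<forall>i\<ge>M. y i = x (i + k)" by blast
  qed
  show "trans (asymptotic_rel X d shift)"
  proof (rule transI, unfold asymptotic_rel_iff[OF assms], elim conjE exE, intro conjI)
    fix x y z and k M l N :: int assume eq: "\<forall>i\<ge>M. x i = y (i + k)" "\<forall>i\<ge>N. y i = z (i + l)"
    have "x i = z (i + (k + l))" if "max M (N - k) \<le> i" for i :: int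
    proof -
      have "M \<le> i" "N \<le> i + k" using that by linarith+
      with eq have "x i = z (i + k + l)" by simp
      then show ?thesis by (simp only: add.assoc)
    qed
    then show "\<exists>k M. \<forall>i\<ge>M. x i = z (i + k)" by blast
  qed
qed

lemma orbit_of_X: "x \<in> X \<Longrightarrow> orbit_of X shift x = range (\<lambda>k i. x (i + k))"
  by (simp add: orbit_of_def int_iterate_shift[OF translate_mem])

lemma unique_asymptotic_class:
  assumes d: "metric_on_subshift X d"
  shows "\<exists>!A. asymptotic_class X d shift A"
proof -
  let ?r = "asymptotic_rel X d shift"
  note rel = asymptotic_rel_iff[OF d] and equiv = equiv_asymptotic_rel[OF d]
  obtain v v' where v: "recurrent_spacer v" "recurrent_spacer v'" "v \<noteq> v'"
    by (rule two_recurrent_spacers)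
  note mem = hole_point_mem[OF v(1)] hole_point_mem[OF v(2)]
  have related: "(hole_point v, x) \<in> ?r" if "x \<in> X" "\<And>i. x (c + int i) = R i" for x c
  proof -
    have "hole_point v i = x (i + c)" if "0 \<le> i" for i
      using \<open>\<And>i. x (c + int i) = R i\<close>[of "nat i"] that by (simp add: hole_point_def add.commute)
    then show ?thesis using mem(1) \<open>x \<in> X\<close> unfolding rel by blast
  qed
  show ?thesis
  proof (rule ex1I)
    show "asymptotic_class X d shift (?r `` {hole_point v})"
      unfolding asymptotic_class_def
    proof (intro conjI notI)
      show "?r `` {hole_point v} \<in> X // ?r" using mem(1) by (rule quotientI)
      assume "\<exists>z\<in>X. ?r `` {hole_point v} = orbit_of X shift z"
      then obtain z where z: "z \<in> X" "?r `` {hole_point v} = range (\<lambda>k i. z (i + k))"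
        using orbit_of_X by blast
      \<comment> \<open>In a single orbit the two hole points would be translates of each
        other.\<close>
      have "hole_point v \<in> ?r `` {hole_point v}" "hole_point v' \<in> ?r `` {hole_point v}"
        using related[OF mem(1), of 0] related[OF mem(2), of 0] by (simp_all add: hole_point_right)
      then obtain k k' where k: "hole_point v = (\<lambda>i. z (i + k))" "hole_point v' = (\<lambda>i. z (i + k'))"
        unfolding z(2) by blast
      have "hole_point v' = (\<lambda>i. hole_point v (i + (k' - k)))"
        by (simp add: k)
      with hole_points_not_translates[OF v(1,3)] show False by blast
    qed
  next
    fix A assume A: "asymptotic_class X d shift A"
    then obtain x where x: "x \<in> X" "A = ?r `` {x}"
      unfolding asymptotic_class_def by (blast elim: quotientE)
    have "orbit_of X shift x \<subseteq> A"
    proof -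
      have "(x, \<lambda>i. x (i + k)) \<in> ?r" for k
      proof -
        have "\<forall>i\<ge>0. x i = x (i + - k + k)" by simp
        then show ?thesis unfolding rel using x(1) translate_mem[OF x(1)] by blast
      qed
      then show ?thesis using x by (auto simp: orbit_of_X)
    qed
    moreover have "A \<noteq> orbit_of X shift x" using A x(1) by (auto simp: asymptotic_class_def)
    ultimately obtain y where y: "(x, y) \<in> ?r" "y \<notin> orbit_of X shift x" using x(2) by blast
    then obtain k M where kM: "\<And>i. M \<le> i \<Longrightarrow> x i = y (i + k)" and "y \<in> X"
      unfolding rel by blast
    \<comment> \<open>Equality would put \<open>y\<close> into the orbit of \<open>x\<close>. So
      \<open>x\<close> and this translate of \<open>y\<close> are distinct points with a common
      right tail, as \<open>common_tail\<close> requires.\<close>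
    have "x \<noteq> (\<lambda>i. y (i + k))"
    proof
      assume "x = (\<lambda>i. y (i + k))"
      then have "y = (\<lambda>i. x (i + - k))" by simp
      then show False using y(2) x(1) unfolding orbit_of_X[OF x(1)] by blast
    qed
    with kM obtain c where "\<And>i. x (c + int i) = R i"
      using common_tail[OF x(1) translate_mem[OF \<open>y \<in> X\<close>]] by metis
    then have "(hole_point v, x) \<in> ?r" using related[OF x(1)] by blast
    then show "A = ?r `` {hole_point v}" using equiv_class_eq[OF equiv] x(2) by blast
  qed
qed

end

theorem proposition4p22:
  fixes q :: "nat \<Rightarrow> nat" and a :: "nat \<Rightarrow> nat \<Rightarrow> nat"
    and d :: "(int \<Rightarrow> nat) \<Rightarrow> (int \<Rightarrow> nat) \<Rightarrow> real"
  assumes "standard q"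
    and "bounded_spacers q a"
    and "aperiodic (ferenczi_subshift q a)"
    and "metric_on_subshift (ferenczi_subshift q a) d"
  shows "\<exists>!A. asymptotic_class (ferenczi_subshift q a) d shift A"
proof -
  obtain C where C: "\<And>n i. i < q n \<Longrightarrow> a n i \<le> C"
    using assms(2) by (auto simp: bounded_spacers_def)
  interpret ferenczi q a C
  proof
    show "1 \<le> q n" for n
      using assms(1)[unfolded standard_def, rule_format, of n] by simp
  qed (use C assms(3) in auto)
  show ?thesis by (rule unique_asymptotic_class[OF assms(4)])
qed

end
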